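(* (a) Under $\gamma\in[0,1]$, the following inequalities hold (for $\delta_1,\delta_2\in B_\delta$): $$\left\Vert \Phi^{\delta,\gamma}(\delta_{1})-\Phi^{\delta,\gamma}(\delta_{2})\right\Vert _{\infty}\leq c_{\gamma}\left\Vert \delta_{1}-\delta_{2}\right\Vert _{\infty},$$ $$\left\Vert \Phi^{\delta,\gamma}(\delta_{1})-\Phi^{\delta,\gamma}(\delta_{2})\right\Vert _{\infty}\leq\widetilde{c_{\gamma}}\left(\left\Vert \max\{\delta_{1},\delta_{2}\}-\delta_{1}\right\Vert _{\infty}+\left\Vert \max\{\delta_{1},\delta_{2}\}-\delta_{2}\right\Vert _{\infty}\right)\leq2\widetilde{c_{\gamma}}\cdot\left\Vert \delta_{1}-\delta_{2}\right\Vert _{\infty},$$ where $$c_{\gamma}=\sup_{j\in\mathcal{J},\,\delta\in B_{\delta}}\ \sum_{k\in\mathcal{J}}\left|\sum_{i\in\mathcal{I}}s_{ik}(\delta)\left(\frac{w_{i}s_{ij}(\delta)}{s_{j}(\delta)}-\gamma\frac{w_{i}s_{i0}(\delta)}{s_{0}(\delta)}\right)\right|$$ and, with all suprema and infima of $s_{iJ^*}(\delta)$ taken over $i\in\mathcal{I}$, $J^*\subset\mathcal{J}$ and $\delta\in B_\delta$, $$\widetilde{c_{\gamma}}=\begin{cases} \sup s_{iJ^{*}}(\delta)=\sup_{i\in\mathcal{I},\,\delta\in B_\delta}(1-s_{i0}(\delta))\leq1 & \text{if }\gamma=0,\\ \sup s_{iJ^{*}}(\delta)-\inf s_{iJ^{*}}(\delta)\leq1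 & \text{if }\gamma=1,\\ \max\left\{ \sup s_{iJ^{*}}(\delta)-\gamma\inf s_{iJ^{*}}(\delta),\ \gamma\sup s_{iJ^{*}}(\delta)-\inf s_{iJ^{*}}(\delta)\right\} & \text{otherwise.} \end{cases}$$ (b) Under $\gamma=0$, $$\left\Vert \Phi^{\delta,\gamma=0}(\delta_{1})-\Phi^{\delta,\gamma=0}(\delta_{2})\right\Vert _{\infty}\leq\sup_{i\in\mathcal{I},\,\delta\in B_{\delta}}\left(1-s_{i0}(\delta)\right)\cdot\left\Vert \delta_{1}-\delta_{2}\right\Vert _{\infty}\leq\left\Vert \delta_{1}-\delta_{2}\right\Vert _{\infty}.$$ (c) If $|\mathcal{J}|=1$, $$\left\Vert \Phi^{\delta,\gamma}(\delta_{1})-\Phi^{\delta,\gamma}(\delta_{2})\right\Vert _{\infty}\leq\widetilde{c_{\gamma}}\cdot\left\Vert \delta_{1}-\delta_{2}\right\Vert _{\infty}\leq\left\Vert \delta_{1}-\delta_{2}\right\Vert _{\infty}.$$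
   Context: Static random coefficient logit (BLP) model. $\mathcal{J}$ is the finite set of products and $\mathcal{I}$ the finite set of consumer types; $w_i$ is the fraction of type $i$ consumers, with $\sum_{i\in\mathcal{I}}w_i=1$; $\mu_{ij}\in\mathbb{R}$ are given. $S_j^{(data)}$ ($j\in\mathcal{J}$) and $S_0^{(data)}$ are the observed market shares of the products and of the outside option. $B_\delta$ denotes the space of vectors $\delta=(\delta_j)_{j\in\mathcal{J}}$ under consideration (a set of real vectors indexed by $\mathcal{J}$, not necessarily all of them). For $\delta\in B_\delta$ the individual choice probabilities are $$s_{ij}(\delta)=\frac{\exp(\delta_j+\mu_{ij})}{1+\sum_{k\in\mathcal{J}}\exp(\delta_k+\mu_{ik})},\quad s_{i0}(\delta)=\frac{1}{1+\sum_{k\in\mathcal{J}}\exp(\delta_k+\mu_{ik})},\quad s_{iJ^*}(\delta)=\sum_{k\in J^*}s_{ik}(\delta)\ (J^*\subset\mathcal{J}),$$ and the aggregates are $s_j(\delta)=\sum_{i}w_is_{ij}(\delta)$, $s_0(\delta)=\sum_i w_is_{i0}(\delta)=1-\sum_{k\in\mathcal{J}}s_k(\delta)$. For $\gamma\in\mathbb{R}$ the mapping $\Phi^{\delta,\gamma}:B_\delta\to B_\delta$ (the superscript $\delta$ is only a label) is $$\Phi_j^{\delta,\gamma}(\delta)=\delta_j+[\log S_j^{(data)}-\log s_j(\delta)]-\gamma[\log S_0^{(data)}-\log s_0(\delta)].$$ $\Vert\cdot\Vert_\infty$ is the sup norm and $\max\{\delta_1,\delta_2\}$ is the componentwise maxi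mum.
   Formalization: The first inequality of (a), with constant c_γ, is stated only when the segment between δ_1 and δ_2 lies in B_δ (it fails for arbitrary B_δ); part (c) is stated for γ in [0,1], as in (a), since its last inequality fails for e.g. γ=2. *)

theory Defs
  imports "HOL-Analysis.Analysis"
begin

text \<open>Products are indexed by a finite type \<open>'j\<close>, consumer types by a finite type \<open>'i\<close>;
  mean utilities are vectors in \<open>real ^ 'j\<close>, and the sup norm on them is \<open>infnorm\<close>.\<close>

definition inner_sum :: "('i \<Rightarrow> 'j \<Rightarrow> real) \<Rightarrow> 'i \<Rightarrow> real ^ 'j::finite \<Rightarrow> real" where
  "inner_sum \<mu> i \<delta> = 1 + (\<Sum>k\<in>UNIV. exp (\<delta> $ k + \<mu> i k))"

definition ind_share :: "('i \<Rightarrow> 'j \<Rightarrow> real) \<Rightarrow> 'i \<Rightarrow> 'j \<Rightarrow> real ^ 'j::finite \<Rightarrow> real" where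
  "ind_share \<mu> i j \<delta> = exp (\<delta> $ j + \<mu> i j) / inner_sum \<mu> i \<delta>"

definition ind_share0 :: "('i \<Rightarrow> 'j \<Rightarrow> real) \<Rightarrow> 'i \<Rightarrow> real ^ 'j::finite \<Rightarrow> real" where
  "ind_share0 \<mu> i \<delta> = 1 / inner_sum \<mu> i \<delta>"

definition ind_share_set :: "('i \<Rightarrow> 'j \<Rightarrow> real) \<Rightarrow> 'i \<Rightarrow> 'j set \<Rightarrow> real ^ 'j::finite \<Rightarrow> real" where
  "ind_share_set \<mu> i J \<delta> = (\<Sum>k\<in>J. ind_share \<mu> i k \<delta>)"

definition share :: "('i::finite \<Rightarrow> real) \<Rightarrow> ('i \<Rightarrow> 'j \<Rightarrow> real) \<Rightarrow> 'j \<Rightarrow> real ^ 'j::finite \<Rightarrow> real" where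
  "share w \<mu> j \<delta> = (\<Sum>i\<in>UNIV. w i * ind_share \<mu> i j \<delta>)"

definition share0 :: "('i::finite \<Rightarrow> real) \<Rightarrow> ('i \<Rightarrow> 'j \<Rightarrow> real) \<Rightarrow> real ^ 'j::finite \<Rightarrow> real" where
  "share0 w \<mu> \<delta> = (\<Sum>i\<in>UNIV. w i * ind_share0 \<mu> i \<delta>)"

definition Phi ::
  "('i::finite \<Rightarrow> real) \<Rightarrow> ('i \<Rightarrow> 'j \<Rightarrow> real) \<Rightarrow> ('j \<Rightarrow> real) \<Rightarrow> real \<Rightarrow> real
    \<Rightarrow> real ^ 'j::finite \<Rightarrow> real ^ 'j" where
  "Phi w \<mu> S S0 \<gamma> \<delta> =
     (\<chi> j. \<delta> $ j + (ln (S j) - ln (share w \<mu> j \<delta>)) - \<gamma> * (ln S0 - ln (share0 w \<mu> \<delta>)))"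

definition cmax :: "real ^ 'j \<Rightarrow> real ^ 'j \<Rightarrow> real ^ 'j::finite" where
  "cmax \<delta>1 \<delta>2 = (\<chi> j. max (\<delta>1 $ j) (\<delta>2 $ j))"

text \<open>All suprema and infima below are of quantities that are bounded over any set \<open>B\<close>
  (choice probabilities lie between 0 and 1), so for nonempty \<open>B\<close> the real-valued
  \<open>SUP\<close> and \<open>INF\<close> are genuine ones.\<close>

definition c_gamma ::
  "('i::finite \<Rightarrow> real) \<Rightarrow> ('i \<Rightarrow> 'j \<Rightarrow> real) \<Rightarrow> (real ^ 'j::finite) set \<Rightarrow> real \<Rightarrow> real" where
  "c_gamma w \<mu> B \<gamma> =
     (SUP (j, \<delta>) \<in> UNIV \<times> B. \<Sum>k\<in>UNIV. \<bar>\<Sum>i\<in>UNIV. ind_share \<mu> i k \<delta> *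
        (w i * ind_share \<mu> i j \<delta> / share w \<mu> j \<delta>
          - \<gamma> * (w i * ind_share0 \<mu> i \<delta> / share0 w \<mu> \<delta>))\<bar>)"

text \<open>The family \<open>F\<close> collects the sets of products over which the extrema are taken.  It is
  kept as a parameter because the infimum depends on whether the empty set of products, whose
  choice probability is 0, is counted.\<close>

definition sup_share ::
  "('i::finite \<Rightarrow> 'j \<Rightarrow> real) \<Rightarrow> 'j set set \<Rightarrow> (real ^ 'j::finite) set \<Rightarrow> real" where
  "sup_share \<mu> F B = (SUP (i, J, \<delta>) \<in> UNIV \<times> F \<times> B. ind_share_set \<mu> i J \<delta>)"

definition inf_share ::
  "('i::finite \<Rightarrow> 'j \<Rightarrow> real) \<Rightarrow> 'j set set \<Rightarrow> (real ^ 'j::finite) set \<Rightarrow> real" where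
  "inf_share \<mu> F B = (INF (i, J, \<delta>) \<in> UNIV \<times> F \<times> B. ind_share_set \<mu> i J \<delta>)"

definition sup_inside ::
  "('i::finite \<Rightarrow> 'j \<Rightarrow> real) \<Rightarrow> (real ^ 'j::finite) set \<Rightarrow> real" where
  "sup_inside \<mu> B = (SUP (i, \<delta>) \<in> UNIV \<times> B. 1 - ind_share0 \<mu> i \<delta>)"

definition c_tilde ::
  "('i::finite \<Rightarrow> 'j \<Rightarrow> real) \<Rightarrow> 'j set set \<Rightarrow> (real ^ 'j::finite) set \<Rightarrow> real \<Rightarrow> real" where
  "c_tilde \<mu> F B \<gamma> =
     (if \<gamma> = 0 then sup_share \<mu> F B
      else if \<gamma> = 1 then sup_share \<mu> F B - inf_share \<mu> F B
      else max (sup_share \<mu> F B - \<gamma> * inf_share \<mu> F B)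
               (\<gamma> * sup_share \<mu> F B - inf_share \<mu> F B))"

end

theory Submission
  imports Defs
begin

text \<open>Up to an additive constant, \<open>Phi\<close> equals
  \<open>\<gamma> ln (\<Sum>i. w i / D i) - ln (\<Sum>i. w i exp (\<mu> i j) / D i)\<close> with \<open>D i = inner_sum \<mu> i \<delta>\<close>.
  Both sums are positive combinations of the \<open>1 / D i\<close>, so a change of \<open>\<delta>\<close> moves the logarithm
  of each by an amount between the extreme changes of the \<open>ln (D i)\<close>.  As \<open>ln (D i)\<close> is a convex
  function of \<open>\<delta>\<close> with gradient \<open>ind_share \<mu> i\<close>, its change is bounded on both sides by
  the inner product of the displacement with choice probabilities at the end points.  This product
  is at most \<open>\<sigma> q\<close>, with \<open>\<sigma>\<close> the largest total choice probability and \<open>q\<close> the largest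
  upward displacement (or 0), and it falls short of that by at least \<open>\<iota>\<close> times the distance from
  \<open>q\<close> to any component, with \<open>\<iota>\<close> the smallest choice probability.  Working with end points only
  keeps everything inside \<open>B\<close>, which need not contain the path through the componentwise maximum;
  the bound with \<open>c_gamma\<close>, in contrast, is a mean value estimate along the segment.\<close>

subsection \<open>Sup norm\<close>

lemma infnorm_attained: "\<exists>k. infnorm (v :: real ^ 'n) = \<bar>v $ k\<bar>"
proof -
  have "infnorm v = Max (range (\<lambda>k. \<bar>v $ k\<bar>))"
    by (simp add: infnorm_cart full_SetCompr_eq cSup_eq_Max)
  moreover have "Max (range (\<lambda>k. \<bar>v $ k\<bar>)) \<in> range (\<lambda>k. \<bar>v $ k\<bar>)"
    by (intro Max_in) auto
  ultimately show ?thesis by (metis rangeE)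
qed

lemma infnorm_leI: "(\<And>j. \<bar>v $ j\<bar> \<le> c) \<Longrightarrow> infnorm (v :: real ^ 'n) \<le> c"
  using infnorm_attained[of v] by metis

text \<open>Because of these positive parts, the norms of \<open>cmax a b - b\<close> and
  \<open>cmax a b - a\<close> are the largest upward and the largest downward component of
  \<open>a - b\<close>, cut off at 0.\<close>

lemma cmax_diff_nth:
  "(cmax a b - a) $ j = max 0 (b $ j - a $ j)"
  "(cmax a b - b) $ j = max 0 (a $ j - b $ j)"
  by (auto simp: cmax_def max_def)

lemma infnorm_cmax_diff_le:
  "infnorm (cmax a b - a) \<le> infnorm (a - b)"
  "infnorm (cmax a b - b) \<le> infnorm (a - b)"
proof -
  have "\<bar>a $ j - b $ j\<bar> \<le> infnorm (a - b)" for j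
    using component_le_infnorm_cart[of "a - b" j] by simp
  then have "max 0 (b $ j - a $ j) \<le> infnorm (a - b) \<and> max 0 (a $ j - b $ j) \<le> infnorm (a - b)" for j
    using infnorm_pos_le[of "a - b"] by (simp add: abs_le_iff)
  then show "infnorm (cmax a b - a) \<le> infnorm (a - b)" "infnorm (cmax a b - b) \<le> infnorm (a - b)"
    by (auto intro!: infnorm_leI simp only: cmax_diff_nth abs_of_nonneg[OF max.cobounded1])
qed

lemma cmax_commute: "cmax a b = cmax b a"
  by (simp add: cmax_def max.commute)

subsection \<open>Choice probabilities\<close>

lemma inner_sum_pos: "inner_sum \<mu> i \<delta> > 0"
  unfolding inner_sum_def by (intro add_pos_nonneg sum_nonneg) auto

lemma inner_sum_neq_0 [simp]: "inner_sum \<mu> i \<delta> \<noteq> 0"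
  using inner_sum_pos by (metis less_irrefl)

lemma ind_share_pos: "ind_share \<mu> i j \<delta> > 0"
  by (simp add: ind_share_def inner_sum_pos)

lemma ind_share0_pos: "ind_share0 \<mu> i \<delta> > 0"
  by (simp add: ind_share0_def inner_sum_pos)

lemma sum_ind_share: "(\<Sum>k\<in>UNIV. ind_share \<mu> i k \<delta>) = 1 - ind_share0 \<mu> i \<delta>"
proof -
  have "(\<Sum>k\<in>UNIV. ind_share \<mu> i k \<delta>) = (inner_sum \<mu> i \<delta> - 1) / inner_sum \<mu> i \<delta>"
    by (simp add: ind_share_def inner_sum_def sum_divide_distrib)
  then show ?thesis
    using inner_sum_pos[of \<mu> i \<delta>] by (simp add: ind_share0_def diff_divide_distrib)
qed

lemma ind_share_set_bounds:
  "0 \<le> ind_share_set \<mu> i J \<delta>"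
  "ind_share_set \<mu> i J \<delta> \<le> 1 - ind_share0 \<mu> i \<delta>"
  "1 - ind_share0 \<mu> i \<delta> \<le> 1"
proof -
  show "0 \<le> ind_share_set \<mu> i J \<delta>"
    by (simp add: ind_share_set_def sum_nonneg ind_share_pos less_imp_le)
  have "ind_share_set \<mu> i J \<delta> \<le> (\<Sum>k\<in>UNIV. ind_share \<mu> i k \<delta>)"
    unfolding ind_share_set_def by (intro sum_mono2) (auto simp: ind_share_pos less_imp_le)
  then show "ind_share_set \<mu> i J \<delta> \<le> 1 - ind_share0 \<mu> i \<delta>"
    by (simp add: sum_ind_share)
  show "1 - ind_share0 \<mu> i \<delta> \<le> 1"
    using ind_share0_pos[of \<mu> i \<delta>] by simp
qed

text \<open>Single weights may vanish, but a total of 1 forces at least one positive term.\<close>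

lemma weighted_sum_pos:
  fixes w :: "'i::finite \<Rightarrow> real"
  assumes "\<And>i. w i \<ge> 0" and "(\<Sum>i\<in>UNIV. w i) = 1" and "\<And>i. f i > 0"
  shows "(\<Sum>i\<in>UNIV. w i * f i) > 0"
proof -
  obtain i where "w i \<noteq> 0"
    using assms(2) by (metis sum.neutral zero_neq_one)
  then have "w i * f i > 0"
    using assms(1)[of i] assms(3)[of i] by simp
  then show ?thesis
    by (intro sum_pos2[of UNIV i]) (use assms in \<open>auto simp: less_imp_le\<close>)
qed

lemma share_pos:
  assumes "\<And>i. w i \<ge> 0" and "(\<Sum>i\<in>UNIV. w i) = 1"
  shows "share w \<mu> j \<delta> > 0" and "share0 w \<mu> \<delta> > 0"
  unfolding share_def share0_def
  by (intro weighted_sum_pos assms ind_share_pos ind_share0_pos)+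

subsection \<open>Secant bounds\<close>

text \<open>This is Jensen's inequality for \<open>exp\<close>: the ratio of
  \<open>inner_sum\<close> at \<open>b\<close> to that at \<open>a\<close> is the mean of the
  exponentiated displacements \<open>b - a\<close> under the choice probabilities at
  \<open>a\<close>, where the outside option has displacement 0.\<close>

lemma ln_inner_sum_diff_le:
  "ln (inner_sum \<mu> i a) - ln (inner_sum \<mu> i b) \<le> (\<Sum>k\<in>UNIV. ind_share \<mu> i k a * (a $ k - b $ k))"
proof -
  define m where "m = (\<Sum>k\<in>UNIV. ind_share \<mu> i k a * (b $ k - a $ k))"
  \<comment> \<open>The tangent line to \<open>exp\<close> at the mean displacement
    \<open>m\<close>.\<close>
  have tangent: "exp m * (1 + x - m) \<le> exp x" for x :: real
  proof -
    have "exp m * (1 + (x - m)) \<le> exp m * exp (x - m)"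
      by (intro mult_left_mono) auto
    then show ?thesis by (simp add: exp_diff algebra_simps)
  qed
  \<comment> \<open>The probabilities, outside option included, add up to 1 and the mean
    displacement is \<open>m\<close>, so the tangent values average to \<open>exp m\<close>.\<close>
  have "exp m = ind_share0 \<mu> i a * (exp m * (1 + 0 - m))
      + (\<Sum>k\<in>UNIV. ind_share \<mu> i k a * (exp m * (1 + (b $ k - a $ k) - m)))"
  proof -
    have lin: "(\<Sum>k\<in>UNIV. s k * (e * (1 + x k - y))) = e * ((1 - y) * sum s UNIV + (\<Sum>k\<in>UNIV. s k * x k))"
      for s x :: "'b \<Rightarrow> real" and e y
      by (simp add: sum_distrib_left sum.distrib[symmetric] algebra_simps)
    show ?thesis
      unfolding lin sum_ind_share m_def[symmetric] by (simp add: algebra_simps)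
  qed
  also have "\<dots> \<le> ind_share0 \<mu> i a * exp 0 + (\<Sum>k\<in>UNIV. ind_share \<mu> i k a * exp (b $ k - a $ k))"
    by (intro add_mono sum_mono mult_left_mono tangent)
       (auto simp: ind_share_pos ind_share0_pos less_imp_le)
  also have "\<dots> = inner_sum \<mu> i b / inner_sum \<mu> i a"
    by (simp add: ind_share0_def ind_share_def inner_sum_def[of \<mu> i b] add_divide_distrib
        sum_divide_distrib exp_add[symmetric] add.commute)
  finally have "m \<le> ln (inner_sum \<mu> i b / inner_sum \<mu> i a)"
    by (subst ln_ge_iff) (auto simp: inner_sum_pos)
  then have "m \<le> ln (inner_sum \<mu> i b) - ln (inner_sum \<mu> i a)"
    by (simp add: ln_div inner_sum_pos)
  moreover have "m = - (\<Sum>k\<in>UNIV. ind_share \<mu> i k a * (a $ k - b $ k))"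
    unfolding m_def by (simp add: sum_negf[symmetric] algebra_simps)
  ultimately show ?thesis by simp
qed

text \<open>The pointwise comparison \<open>f i \<le> exp c * g i\<close> survives summation with
  nonnegative weights.\<close>

lemma ln_weighted_sum_diff_le:
  fixes w :: "'i::finite \<Rightarrow> real"
  assumes w: "\<And>i. w i \<ge> 0" "(\<Sum>i\<in>UNIV. w i) = 1"
    and f: "\<And>i. f i > 0" and g: "\<And>i. g i > 0"
    and le: "\<And>i. ln (f i) - ln (g i) \<le> c"
  shows "ln (\<Sum>i\<in>UNIV. w i * f i) - ln (\<Sum>i\<in>UNIV. w i * g i) \<le> c"
proof -
  have "f i \<le> exp c * g i" for i
    using le[of i] f[of i] g[of i]
    by (metis add.commute diff_le_eq exp_add exp_le_cancel_iff exp_ln)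
  then have "(\<Sum>i\<in>UNIV. w i * f i) \<le> exp c * (\<Sum>i\<in>UNIV. w i * g i)"
    unfolding sum_distrib_left using w(1)
    by (intro sum_mono) (metis mult.left_commute mult_left_mono)
  then have "ln (\<Sum>i\<in>UNIV. w i * f i) \<le> ln (exp c * (\<Sum>i\<in>UNIV. w i * g i))"
    using weighted_sum_pos[OF w, of f] f by (intro ln_mono) auto
  also have "\<dots> = c + ln (\<Sum>i\<in>UNIV. w i * g i)"
    using weighted_sum_pos[OF w, of g] g by (subst ln_mult) auto
  finally show ?thesis by simp
qed

text \<open>The term \<open>\<delta> $ j\<close> of \<open>Phi\<close> cancels against the exponent
  in \<open>ind_share\<close>, leaving only changes of
  \<open>ln (inner_sum \<mu> i \<delta>)\<close>. Their upper bound enters through the share of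
  \<open>j\<close>, their lower bound through the outside share, scaled by \<gamma>.\<close>

lemma Phi_diff_le:
  assumes w: "\<And>i. w i \<ge> 0" "(\<Sum>i\<in>UNIV. w i) = 1" and \<gamma>: "0 \<le> \<gamma>"
    and up: "\<And>i. ln (inner_sum \<mu> i a) - ln (inner_sum \<mu> i b) \<le> M"
    and lo: "\<And>i. m \<le> ln (inner_sum \<mu> i a) - ln (inner_sum \<mu> i b)"
  shows "Phi w \<mu> S S0 \<gamma> a $ j - Phi w \<mu> S S0 \<gamma> b $ j \<le> M - \<gamma> * m"
proof -
  have "ln (ind_share \<mu> i j b) - ln (ind_share \<mu> i j a) \<le> b $ j - a $ j + M" for i
    using up[of i] by (simp add: ind_share_def ln_div inner_sum_pos)
  then have 1: "ln (share w \<mu> j b) - ln (share w \<mu> j a) \<le> b $ j - a $ j + M"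
    unfolding share_def by (intro ln_weighted_sum_diff_le w ind_share_pos)
  have "ln (ind_share0 \<mu> i a) - ln (ind_share0 \<mu> i b) \<le> - m" for i
    using lo[of i] by (simp add: ind_share0_def ln_div inner_sum_pos)
  then have "ln (share0 w \<mu> a) - ln (share0 w \<mu> b) \<le> - m"
    unfolding share0_def by (intro ln_weighted_sum_diff_le w ind_share0_pos)
  then have "\<gamma> * (ln (share0 w \<mu> a) - ln (share0 w \<mu> b)) \<le> \<gamma> * (- m)"
    using \<gamma> by (rule mult_left_mono)
  with 1 show ?thesis by (simp add: Phi_def algebra_simps)
qed

text \<open>The shortfalls \<open>s k * (q - d k)\<close> from a constant displacement
  \<open>q\<close> are nonnegative, so their sum is at least the one at \<open>l\<close>, whose
  weight is at least \<iota>. The component \<open>l\<close> is free, to be chosen where the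
  shortfall is large.\<close>

lemma weighted_sum_le:
  fixes s d :: "'n::finite \<Rightarrow> real"
  assumes s: "\<And>k. \<iota> \<le> s k" "0 \<le> \<iota>" "(\<Sum>k\<in>UNIV. s k) \<le> \<sigma>"
    and d: "\<And>k. d k \<le> q" "0 \<le> q"
  shows "(\<Sum>k\<in>UNIV. s k * d k) \<le> \<sigma> * q - \<iota> * (q - d l)"
proof -
  have nonneg: "0 \<le> s k * (q - d k)" for k
    using s(1)[of k] s(2) d(1)[of k] by simp
  have "\<iota> * (q - d l) \<le> s l * (q - d l)"
    using s(1)[of l] d(1)[of l] by (intro mult_right_mono) auto
  also have "\<dots> \<le> (\<Sum>k\<in>UNIV. s k * (q - d k))"
    by (rule member_le_sum) (auto simp: nonneg)
  also have "\<dots> = (\<Sum>k\<in>UNIV. s k) * q - (\<Sum>k\<in>UNIV. s k * d k)"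
    by (simp add: right_diff_distrib sum_subtractf sum_distrib_right)
  also have "\<dots> \<le> \<sigma> * q - (\<Sum>k\<in>UNIV. s k * d k)"
    using s(3) d(2) by (simp add: mult_right_mono)
  finally show ?thesis by simp
qed

lemma ln_inner_sum_diff_le_cmax:
  assumes s: "\<And>k. \<iota> \<le> ind_share \<mu> i k a" "0 \<le> \<iota>" "1 - ind_share0 \<mu> i a \<le> \<sigma>"
  shows "ln (inner_sum \<mu> i a) - ln (inner_sum \<mu> i b)
    \<le> \<sigma> * infnorm (cmax a b - b) - \<iota> * (infnorm (cmax a b - b) - (a $ l - b $ l))"
proof -
  have "a $ k - b $ k \<le> infnorm (cmax a b - b)" for k
    using component_le_infnorm_cart[of "cmax a b - b" k] unfolding cmax_diff_nth by simp
  then have "(\<Sum>k\<in>UNIV. ind_share \<mu> i k a * (a $ k - b $ k))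
      \<le> \<sigma> * infnorm (cmax a b - b) - \<iota> * (infnorm (cmax a b - b) - (a $ l - b $ l))"
    by (intro weighted_sum_le) (use s in \<open>auto simp: sum_ind_share infnorm_pos_le\<close>)
  with ln_inner_sum_diff_le show ?thesis by (rule order_trans)
qed

text \<open>The upper and the lower bound on the change of the log sums each gain a correction with
  factor \<iota>. Keeping a suitable part of these corrections reduces the factor \<sigma> to
  \<open>\<sigma> - \<gamma> * \<iota>\<close>.\<close>

lemma Phi_diff_le_cmax:
  assumes w: "\<And>i. w i \<ge> 0" "(\<Sum>i\<in>UNIV. w i) = 1" and \<gamma>: "0 \<le> \<gamma>" "\<gamma> \<le> 1"
    and \<iota>: "\<And>i k. \<iota> \<le> ind_share \<mu> i k a" "\<And>i k. \<iota> \<le> ind_share \<mu> i k b" "0 \<le> \<iota>"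
    and \<sigma>: "\<And>i. 1 - ind_share0 \<mu> i a \<le> \<sigma>" "\<And>i. 1 - ind_share0 \<mu> i b \<le> \<sigma>" "\<iota> \<le> \<sigma>"
  shows "Phi w \<mu> S S0 \<gamma> a $ j - Phi w \<mu> S S0 \<gamma> b $ j
    \<le> (\<sigma> - \<gamma> * \<iota>) * (infnorm (cmax a b - a) + infnorm (cmax a b - b))"
proof -
  define p q where "p = infnorm (cmax a b - a)" and "q = infnorm (cmax a b - b)"
  \<comment> \<open>The largest downward displacement occurs at \<open>k\<close>, the largest upward
    one at \<open>l\<close>. Each index serves below in the bound for the opposite direction, where
    it lies farthest from the extreme.\<close>
  obtain k where k: "p = max 0 (b $ k - a $ k)"
    unfolding p_def using infnorm_attained[of "cmax a b - a"] unfolding cmax_diff_nth by auto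
  obtain l where l: "q = max 0 (a $ l - b $ l)"
    unfolding q_def using infnorm_attained[of "cmax a b - b"] unfolding cmax_diff_nth by auto
  have up: "ln (inner_sum \<mu> i a) - ln (inner_sum \<mu> i b) \<le> \<sigma> * q - \<iota> * (q - (a $ k - b $ k))" for i
    unfolding q_def by (intro ln_inner_sum_diff_le_cmax \<iota> \<sigma>)
  have lo: "- (\<sigma> * p - \<iota> * (p - (b $ l - a $ l))) \<le> ln (inner_sum \<mu> i a) - ln (inner_sum \<mu> i b)" for i
    using ln_inner_sum_diff_le_cmax[of \<iota> \<mu> i b \<sigma> a l] \<iota> \<sigma>
    unfolding p_def by (simp add: cmax_commute[of b a])
  have "Phi w \<mu> S S0 \<gamma> a $ j - Phi w \<mu> S S0 \<gamma> b $ j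
      \<le> \<sigma> * q - \<iota> * (q - (a $ k - b $ k)) - \<gamma> * - (\<sigma> * p - \<iota> * (p - (b $ l - a $ l)))"
    by (intro Phi_diff_le w \<gamma> up lo)
  also have "\<dots> \<le> (\<sigma> - \<gamma> * \<iota>) * (p + q)"
  proof -
    have pl: "p \<ge> b $ l - a $ l" "q \<ge> a $ k - b $ k"
      using component_le_infnorm_cart[of "cmax a b - a" l] component_le_infnorm_cart[of "cmax a b - b" k]
      unfolding p_def q_def cmax_diff_nth by simp_all
    have pq: "0 \<le> p" "0 \<le> q" using k l by auto
    have gi: "0 \<le> \<gamma> * \<iota>" "\<gamma> * \<iota> \<le> \<iota>" "\<gamma> * \<sigma> \<le> \<sigma>"
      using \<gamma> \<iota>(3) \<sigma>(3) by (auto intro: mult_left_le_one_le)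
    have gsp: "\<gamma> * \<sigma> * p \<le> \<sigma> * p"
      using gi(3) pq(1) by (rule mult_right_mono)
    \<comment> \<open>A maximum that equals 0 by the cut-off need not be a displacement at its
      index. In \<open>up\<close> the correction at \<open>l\<close> does the work, in
      \<open>down\<close> the one at \<open>k\<close>; in \<open>mixed\<close> both have size
      proportional to \<open>p + q\<close>. If neither displacement is positive, \<open>pl\<close>
      forces \<open>a $ l = b $ l\<close>, which falls under \<open>up\<close>.\<close>
    consider (up) "p = 0" "q = a $ l - b $ l" | (down) "q = 0" "p = b $ k - a $ k"
      | (mixed) "p = b $ k - a $ k" "q = a $ l - b $ l"
      using k l pl by linarith
    then show ?thesis
    proof cases
      case up
      have 1: "0 \<le> \<iota> * (q - (a $ k - b $ k))" using pl \<iota>(3) by simp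
      have 2: "b $ l - a $ l = - q" using up by simp
      show ?thesis unfolding 2 using 1 up(1) by (simp add: algebra_simps)
    next
      case down
      have 1: "0 \<le> \<gamma> * \<iota> * (p - (b $ l - a $ l))" using pl gi(1) by simp
      have 2: "\<gamma> * \<iota> * p \<le> \<iota> * p" using gi(2) pq(1) by (rule mult_right_mono)
      have 3: "0 \<le> \<iota> * p" using \<iota>(3) pq(1) by simp
      have 4: "a $ k - b $ k = - p" using down by simp
      show ?thesis unfolding 4 using 1 2 3 gsp down(1) by (simp add: algebra_simps)
    next
      case mixed
      have 1: "\<gamma> * \<iota> * (p + q) \<le> \<iota> * (p + q)" using gi(2) pq by (intro mult_right_mono) auto
      have 2: "0 \<le> \<gamma> * \<iota> * (p + q)" using gi(1) pq by simp
      have 3: "a $ k - b $ k = - p" "b $ l - a $ l = - q" using mixed by auto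
      show ?thesis unfolding 3 using 1 2 gsp by (simp add: algebra_simps)
    qed
  qed
  finally show ?thesis by (simp add: p_def q_def)
qed

text \<open>Without the outside share only the upward displacement counts, so a single
  \<open>infnorm (a - b)\<close> replaces the sum of two norms.\<close>

lemma Phi_0_diff_le:
  assumes w: "\<And>i. w i \<ge> 0" "(\<Sum>i\<in>UNIV. w i) = 1"
    and \<sigma>: "\<And>i. 1 - ind_share0 \<mu> i a \<le> \<sigma>" "0 \<le> \<sigma>"
  shows "Phi w \<mu> S S0 0 a $ j - Phi w \<mu> S S0 0 b $ j \<le> \<sigma> * infnorm (a - b)"
proof -
  \<comment> \<open>\<open>Phi_diff_le\<close> asks for a lower bound that is multiplied by 0 here;
    the minimum over the finitely many types supplies one.\<close>
  define m where "m = Min (range (\<lambda>i. ln (inner_sum \<mu> i a) - ln (inner_sum \<mu> i b)))"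
  have up: "ln (inner_sum \<mu> i a) - ln (inner_sum \<mu> i b) \<le> \<sigma> * infnorm (a - b)" for i
  proof -
    have "ln (inner_sum \<mu> i a) - ln (inner_sum \<mu> i b) \<le> \<sigma> * infnorm (cmax a b - b)"
      using ln_inner_sum_diff_le_cmax[of 0 \<mu> i a \<sigma>] \<sigma> by (simp add: ind_share_pos less_imp_le)
    also have "\<dots> \<le> \<sigma> * infnorm (a - b)"
      by (intro mult_left_mono infnorm_cmax_diff_le \<sigma>)
    finally show ?thesis .
  qed
  have "Phi w \<mu> S S0 0 a $ j - Phi w \<mu> S S0 0 b $ j \<le> \<sigma> * infnorm (a - b) - 0 * m"
    by (intro Phi_diff_le w up) (auto simp: m_def)
  then show ?thesis by simp
qed

lemma infnorm_Phi_0_diff_le: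
  assumes w: "\<And>i. w i \<ge> 0" "(\<Sum>i\<in>UNIV. w i) = 1"
    and \<sigma>: "\<And>i. 1 - ind_share0 \<mu> i a \<le> \<sigma>" "\<And>i. 1 - ind_share0 \<mu> i b \<le> \<sigma>" "0 \<le> \<sigma>"
  shows "infnorm (Phi w \<mu> S S0 0 a - Phi w \<mu> S S0 0 b) \<le> \<sigma> * infnorm (a - b)"
proof (rule infnorm_leI)
  fix j
  have "Phi w \<mu> S S0 0 a $ j - Phi w \<mu> S S0 0 b $ j \<le> \<sigma> * infnorm (a - b)"
    by (intro Phi_0_diff_le w \<sigma>)
  moreover have "Phi w \<mu> S S0 0 b $ j - Phi w \<mu> S S0 0 a $ j \<le> \<sigma> * infnorm (b - a)"
    by (intro Phi_0_diff_le w \<sigma>)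
  ultimately show "\<bar>(Phi w \<mu> S S0 0 a - Phi w \<mu> S S0 0 b) $ j\<bar> \<le> \<sigma> * infnorm (a - b)"
    by (simp add: infnorm_sub abs_le_iff)
qed

lemma infnorm_Phi_diff_le_cmax:
  assumes w: "\<And>i. w i \<ge> 0" "(\<Sum>i\<in>UNIV. w i) = 1" and \<gamma>: "0 \<le> \<gamma>" "\<gamma> \<le> 1"
    and \<iota>: "\<And>i k. \<iota> \<le> ind_share \<mu> i k a" "\<And>i k. \<iota> \<le> ind_share \<mu> i k b" "0 \<le> \<iota>"
    and \<sigma>: "\<And>i. 1 - ind_share0 \<mu> i a \<le> \<sigma>" "\<And>i. 1 - ind_share0 \<mu> i b \<le> \<sigma>" "\<iota> \<le> \<sigma>"
  shows "infnorm (Phi w \<mu> S S0 \<gamma> a - Phi w \<mu> S S0 \<gamma> b)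
    \<le> (\<sigma> - \<gamma> * \<iota>) * (infnorm (cmax a b - a) + infnorm (cmax a b - b))"
proof (rule infnorm_leI)
  fix j
  let ?c = "(\<sigma> - \<gamma> * \<iota>) * (infnorm (cmax a b - a) + infnorm (cmax a b - b))"
  have "Phi w \<mu> S S0 \<gamma> a $ j - Phi w \<mu> S S0 \<gamma> b $ j \<le> ?c"
    by (intro Phi_diff_le_cmax w \<gamma> \<iota> \<sigma>)
  moreover have "Phi w \<mu> S S0 \<gamma> b $ j - Phi w \<mu> S S0 \<gamma> a $ j
      \<le> (\<sigma> - \<gamma> * \<iota>) * (infnorm (cmax b a - b) + infnorm (cmax b a - a))"
    by (intro Phi_diff_le_cmax w \<gamma> \<iota> \<sigma>)
  ultimately show "\<bar>(Phi w \<mu> S S0 \<gamma> a - Phi w \<mu> S S0 \<gamma> b) $ j\<bar> \<le> ?c"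
    by (simp add: cmax_commute[of b a] add.commute abs_le_iff)
qed

subsection \<open>Mean value bound\<close>

text \<open>The partial derivative of component \<open>j\<close> of \<open>Phi\<close> with respect
  to \<open>\<delta> $ k\<close>, written exactly as the term inside the absolute value of
  \<open>c_gamma\<close>.\<close>

definition Phi_jac ::
  "('i::finite \<Rightarrow> real) \<Rightarrow> ('i \<Rightarrow> 'j \<Rightarrow> real) \<Rightarrow> real \<Rightarrow> 'j \<Rightarrow> 'j \<Rightarrow> real ^ 'j::finite \<Rightarrow> real" where
  "Phi_jac w \<mu> \<gamma> j k \<delta> = (\<Sum>i\<in>UNIV. ind_share \<mu> i k \<delta> *
     (w i * ind_share \<mu> i j \<delta> / share w \<mu> j \<delta> - \<gamma> * (w i * ind_share0 \<mu> i \<delta> / share0 w \<mu> \<delta>)))"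

text \<open>With \<open>inner_sum\<close> factored out, what remains is the mean of the direction
  \<open>d\<close> under the choice probabilities, the form in which the quotient rule
  simplifies.\<close>

lemma has_field_derivative_inner_sum_line:
  "((\<lambda>t. inner_sum \<mu> i (b + t *\<^sub>R d)) has_field_derivative
     inner_sum \<mu> i (b + t *\<^sub>R d) * (\<Sum>k\<in>UNIV. ind_share \<mu> i k (b + t *\<^sub>R d) * d $ k)) (at t)"
proof -
  have "inner_sum \<mu> i (b + t *\<^sub>R d) * (\<Sum>k\<in>UNIV. ind_share \<mu> i k (b + t *\<^sub>R d) * d $ k)
      = (\<Sum>k\<in>UNIV. exp ((b + t *\<^sub>R d) $ k + \<mu> i k) * d $ k)"
    using inner_sum_pos[of \<mu> i "b + t *\<^sub>R d"] by (simp add: ind_share_def sum_distrib_left)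
  then show ?thesis
    unfolding inner_sum_def
    by (auto intro!: derivative_eq_intros sum.cong)
qed

lemma has_field_derivative_ind_share_line:
  fixes b d :: "real ^ 'j::finite"
  defines "x \<equiv> (\<lambda>t. b + t *\<^sub>R d)"
  shows "((\<lambda>t. ind_share \<mu> i j (x t)) has_field_derivative
     ind_share \<mu> i j (x t) * (d $ j - (\<Sum>k\<in>UNIV. ind_share \<mu> i k (x t) * d $ k))) (at t)"
    and "((\<lambda>t. ind_share0 \<mu> i (x t)) has_field_derivative
     - (ind_share0 \<mu> i (x t) * (\<Sum>k\<in>UNIV. ind_share \<mu> i k (x t) * d $ k))) (at t)"
proof -
  let ?D = "inner_sum \<mu> i (x t)" and ?m = "\<Sum>k\<in>UNIV. ind_share \<mu> i k (x t) * d $ k"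
  have D: "((\<lambda>t. inner_sum \<mu> i (x t)) has_field_derivative ?D * ?m) (at t)"
    unfolding x_def by (rule has_field_derivative_inner_sum_line)
  have nz: "?D \<noteq> 0" using inner_sum_pos[of \<mu> i "x t"] by simp
  have E: "((\<lambda>t. exp (x t $ j + \<mu> i j)) has_field_derivative exp (x t $ j + \<mu> i j) * d $ j) (at t)"
    unfolding x_def by (auto intro!: derivative_eq_intros)
  \<comment> \<open>The left sides have the shape produced by \<open>DERIV_divide\<close>, the right
    sides that of the claimed derivatives.\<close>
  have quotient: "(e * c * D - e * (D * m)) / (D * D) = e / D * (c - m)"
    "(0 * D - 1 * (D * m)) / (D * D) = - (1 / D * m)" if "D \<noteq> 0" for e c D m :: real
    using that by (simp_all add: field_simps)
  show "((\<lambda>t. ind_share \<mu> i j (x t)) has_field_derivative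
      ind_share \<mu> i j (x t) * (d $ j - ?m)) (at t)"
    using DERIV_divide[OF E D nz] unfolding quotient[OF nz] ind_share_def[symmetric] .
  show "((\<lambda>t. ind_share0 \<mu> i (x t)) has_field_derivative - (ind_share0 \<mu> i (x t) * ?m)) (at t)"
    using DERIV_divide[OF DERIV_const[of 1] D nz] unfolding quotient[OF nz] ind_share0_def[symmetric] .
qed

lemma has_field_derivative_Phi_line:
  assumes w: "\<And>i. w i \<ge> 0" "(\<Sum>i\<in>UNIV. w i) = 1"
  shows "((\<lambda>t. Phi w \<mu> S S0 \<gamma> (b + t *\<^sub>R d) $ j) has_field_derivative
     (\<Sum>k\<in>UNIV. Phi_jac w \<mu> \<gamma> j k (b + t *\<^sub>R d) * d $ k)) (at t)"
proof -
  define x where "x = (\<lambda>t. b + t *\<^sub>R d)"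
  define m where "m = (\<lambda>i. \<Sum>k\<in>UNIV. ind_share \<mu> i k (x t) * d $ k)"
  let ?s = "share w \<mu> j (x t)" and ?z = "share0 w \<mu> (x t)"
  let ?A = "\<Sum>i\<in>UNIV. w i * ind_share \<mu> i j (x t) * m i"
    and ?Z = "\<Sum>i\<in>UNIV. w i * ind_share0 \<mu> i (x t) * m i"
  have pos: "?s > 0" "?z > 0" by (rule share_pos[OF w])+
  have "((\<lambda>t. share w \<mu> j (x t)) has_field_derivative
      (\<Sum>i\<in>UNIV. w i * (ind_share \<mu> i j (x t) * (d $ j - m i)))) (at t)"
    unfolding share_def x_def m_def
    by (intro DERIV_sum DERIV_cmult has_field_derivative_ind_share_line)
  also have "(\<Sum>i\<in>UNIV. w i * (ind_share \<mu> i j (x t) * (d $ j - m i))) = d $ j * ?s - ?A"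
    by (simp add: share_def sum_distrib_left sum_subtractf algebra_simps)
  finally have s: "((\<lambda>t. share w \<mu> j (x t)) has_field_derivative d $ j * ?s - ?A) (at t)" .
  have "((\<lambda>t. share0 w \<mu> (x t)) has_field_derivative
      (\<Sum>i\<in>UNIV. w i * - (ind_share0 \<mu> i (x t) * m i))) (at t)"
    unfolding share0_def x_def m_def
    by (intro DERIV_sum DERIV_cmult has_field_derivative_ind_share_line)
  also have "(\<Sum>i\<in>UNIV. w i * - (ind_share0 \<mu> i (x t) * m i)) = - ?Z"
    by (simp add: sum_negf[symmetric] mult.assoc)
  finally have s0: "((\<lambda>t. share0 w \<mu> (x t)) has_field_derivative - ?Z) (at t)" .
  have c: "((\<lambda>t. x t $ j) has_field_derivative d $ j) (at t)"
    unfolding x_def by (auto intro!: derivative_eq_intros)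
  have "((\<lambda>t. Phi w \<mu> S S0 \<gamma> (x t) $ j) has_field_derivative
      d $ j + (0 - (d $ j * ?s - ?A) / ?s) - \<gamma> * (0 - (- ?Z) / ?z)) (at t)"
    unfolding Phi_def vec_lambda_beta
    by (intro DERIV_diff DERIV_add DERIV_cmult c DERIV_const)
       (auto intro!: derivative_eq_intros s s0 pos simp: divide_inverse)
  \<comment> \<open>The derivative \<open>d $ j\<close> of the linear term cancels against the same
    term in the logarithmic derivative of the share of \<open>j\<close>.\<close>
  also have "d $ j + (0 - (d $ j * ?s - ?A) / ?s) - \<gamma> * (0 - (- ?Z) / ?z) = ?A / ?s - \<gamma> * (?Z / ?z)"
    using pos by (simp add: field_simps)
  also have "\<dots> = (\<Sum>i\<in>UNIV. m i * (w i * ind_share \<mu> i j (x t) / ?s - \<gamma> * (w i * ind_share0 \<mu> i (x t) / ?z)))"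
    by (simp add: sum_divide_distrib sum_distrib_left sum_subtractf algebra_simps)
  also have "\<dots> = (\<Sum>k\<in>UNIV. Phi_jac w \<mu> \<gamma> j k (x t) * d $ k)"
    unfolding m_def Phi_jac_def sum_distrib_right
    by (subst sum.swap) (simp add: mult.assoc mult.left_commute mult.commute)
  finally show ?thesis by (simp add: x_def)
qed

text \<open>Provides the boundedness that makes the supremum in \<open>c_gamma\<close> an upper
  bound. Both \<open>u\<close> and \<open>v\<close> are probability distributions over types, and
  the choice probabilities of one type sum to at most 1 over the products.\<close>

lemma sum_abs_Phi_jac_le:
  assumes w: "\<And>i. w i \<ge> 0" "(\<Sum>i\<in>UNIV. w i) = 1" and \<gamma>: "0 \<le> \<gamma>"
  shows "(\<Sum>k\<in>UNIV. \<bar>Phi_jac w \<mu> \<gamma> j k \<delta>\<bar>) \<le> 1 + \<gamma>"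
proof -
  define u v where "u = (\<lambda>i. w i * ind_share \<mu> i j \<delta> / share w \<mu> j \<delta>)"
    and "v = (\<lambda>i. w i * ind_share0 \<mu> i \<delta> / share0 w \<mu> \<delta>)"
  have pos: "share w \<mu> j \<delta> > 0" "share0 w \<mu> \<delta> > 0" by (rule share_pos[OF w])+
  have nonneg: "0 \<le> u i" "0 \<le> v i" for i
    using pos w(1)[of i] ind_share_pos[of \<mu> i j \<delta>] ind_share0_pos[of \<mu> i \<delta>]
    by (auto simp: u_def v_def)
  have sums: "(\<Sum>i\<in>UNIV. u i) = 1" "(\<Sum>i\<in>UNIV. v i) = 1"
    using pos by (simp_all add: u_def v_def sum_divide_distrib[symmetric] share_def[symmetric] share0_def[symmetric])
  have "\<bar>Phi_jac w \<mu> \<gamma> j k \<delta>\<bar> \<le> (\<Sum>i\<in>UNIV. ind_share \<mu> i k \<delta> * (u i + \<gamma> * v i))" for k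
  proof -
    have "\<bar>Phi_jac w \<mu> \<gamma> j k \<delta>\<bar> \<le> (\<Sum>i\<in>UNIV. \<bar>ind_share \<mu> i k \<delta> * (u i - \<gamma> * v i)\<bar>)"
      unfolding Phi_jac_def u_def v_def by (rule sum_abs)
    also have "\<dots> \<le> (\<Sum>i\<in>UNIV. ind_share \<mu> i k \<delta> * (u i + \<gamma> * v i))"
    proof (rule sum_mono)
      fix i
      have "0 \<le> \<gamma> * v i" using \<gamma> nonneg by simp
      then have "\<bar>u i - \<gamma> * v i\<bar> \<le> u i + \<gamma> * v i" using nonneg(1)[of i] by linarith
      then show "\<bar>ind_share \<mu> i k \<delta> * (u i - \<gamma> * v i)\<bar> \<le> ind_share \<mu> i k \<delta> * (u i + \<gamma> * v i)"
        using ind_share_pos[of \<mu> i k \<delta>] by (simp add: abs_mult)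
    qed
    finally show ?thesis .
  qed
  then have "(\<Sum>k\<in>UNIV. \<bar>Phi_jac w \<mu> \<gamma> j k \<delta>\<bar>)
      \<le> (\<Sum>k\<in>UNIV. \<Sum>i\<in>UNIV. ind_share \<mu> i k \<delta> * (u i + \<gamma> * v i))"
    by (rule sum_mono)
  also have "\<dots> = (\<Sum>i\<in>UNIV. (1 - ind_share0 \<mu> i \<delta>) * (u i + \<gamma> * v i))"
    by (subst sum.swap) (simp add: sum_distrib_right[symmetric] sum_ind_share)
  also have "\<dots> \<le> (\<Sum>i\<in>UNIV. 1 * (u i + \<gamma> * v i))"
    using \<gamma> nonneg by (intro sum_mono mult_right_mono ind_share_set_bounds) simp
  also have "\<dots> = 1 + \<gamma>"
    by (simp add: sum.distrib sum_distrib_left[symmetric] sums)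
  finally show ?thesis .
qed

text \<open>The mean value theorem is applied to each component separately, so the intermediate
  point depends on \<open>j\<close>. The segment condition puts all these points into
  \<open>B\<close>, over which \<open>c_gamma\<close> takes its supremum.\<close>

lemma infnorm_Phi_diff_le_c_gamma:
  assumes w: "\<And>i. w i \<ge> 0" "(\<Sum>i\<in>UNIV. w i) = 1" and \<gamma>: "0 \<le> \<gamma>"
    and seg: "closed_segment a b \<subseteq> B"
  shows "infnorm (Phi w \<mu> S S0 \<gamma> a - Phi w \<mu> S S0 \<gamma> b) \<le> c_gamma w \<mu> B \<gamma> * infnorm (a - b)"
proof (rule infnorm_leI)
  fix j
  define d where "d = a - b"
  obtain t where t: "0 < t" "t < 1"
    and mvt: "Phi w \<mu> S S0 \<gamma> (b + 1 *\<^sub>R d) $ j - Phi w \<mu> S S0 \<gamma> (b + 0 *\<^sub>R d) $ j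
      = (1 - 0) * (\<Sum>k\<in>UNIV. Phi_jac w \<mu> \<gamma> j k (b + t *\<^sub>R d) * d $ k)"
    using MVT2[OF zero_less_one has_field_derivative_Phi_line[OF w,
      where \<mu> = \<mu> and S = S and ?S0.0 = S0 and \<gamma> = \<gamma> and b = b and d = d and j = j]] by blast
  let ?\<xi> = "b + t *\<^sub>R d"
  have "?\<xi> \<in> closed_segment b a"
    unfolding in_segment using t by (intro exI[of _ t]) (auto simp: d_def algebra_simps)
  then have \<xi>: "?\<xi> \<in> B" using seg closed_segment_commute by blast
  have bdd: "bdd_above ((\<lambda>(j, \<delta>). \<Sum>k\<in>UNIV. \<bar>Phi_jac w \<mu> \<gamma> j k \<delta>\<bar>) ` (UNIV \<times> B))"
    by (intro bdd_aboveI[of _ "1 + \<gamma>"]) (auto intro: sum_abs_Phi_jac_le[OF w \<gamma>])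
  have "\<bar>Phi w \<mu> S S0 \<gamma> a $ j - Phi w \<mu> S S0 \<gamma> b $ j\<bar> = \<bar>\<Sum>k\<in>UNIV. Phi_jac w \<mu> \<gamma> j k ?\<xi> * d $ k\<bar>"
    using mvt by (simp add: d_def)
  also have "\<dots> \<le> (\<Sum>k\<in>UNIV. \<bar>Phi_jac w \<mu> \<gamma> j k ?\<xi> * d $ k\<bar>)"
    by (rule sum_abs)
  also have "\<dots> \<le> (\<Sum>k\<in>UNIV. \<bar>Phi_jac w \<mu> \<gamma> j k ?\<xi>\<bar> * infnorm d)"
    unfolding abs_mult by (intro sum_mono mult_left_mono component_le_infnorm_cart) auto
  also have "\<dots> = (\<Sum>k\<in>UNIV. \<bar>Phi_jac w \<mu> \<gamma> j k ?\<xi>\<bar>) * infnorm d"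
    by (simp add: sum_distrib_right)
  also have "\<dots> \<le> c_gamma w \<mu> B \<gamma> * infnorm d"
  proof (rule mult_right_mono[OF _ infnorm_pos_le])
    show "(\<Sum>k\<in>UNIV. \<bar>Phi_jac w \<mu> \<gamma> j k ?\<xi>\<bar>) \<le> c_gamma w \<mu> B \<gamma>"
      unfolding c_gamma_def Phi_jac_def[symmetric]
      using cSUP_upper[OF _ bdd, of "(j, ?\<xi>)"] \<xi> by simp
  qed
  finally show "\<bar>(Phi w \<mu> S S0 \<gamma> a - Phi w \<mu> S S0 \<gamma> b) $ j\<bar> \<le> c_gamma w \<mu> B \<gamma> * infnorm (a - b)"
    by (simp add: d_def)
qed

subsection \<open>Extremal choice probabilities\<close>

lemma bdd_ind_share_set:
  "bdd_above ((\<lambda>(i, J, \<delta>). ind_share_set \<mu> i J \<delta>) ` X)"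
  "bdd_below ((\<lambda>(i, J, \<delta>). ind_share_set \<mu> i J \<delta>) ` X)"
proof -
  have "ind_share_set \<mu> i J \<delta> \<le> 1" for i J \<delta>
    using ind_share_set_bounds(2,3) by (rule order_trans)
  then show "bdd_above ((\<lambda>(i, J, \<delta>). ind_share_set \<mu> i J \<delta>) ` X)"
    by (intro bdd_aboveI[of _ 1]) auto
  show "bdd_below ((\<lambda>(i, J, \<delta>). ind_share_set \<mu> i J \<delta>) ` X)"
    by (intro bdd_belowI[of _ 0]) (auto simp: ind_share_set_bounds)
qed

lemma sup_share_upper:
  assumes "J \<in> F" "\<delta> \<in> B"
  shows "ind_share_set \<mu> i J \<delta> \<le> sup_share \<mu> F B"
  unfolding sup_share_def using cSUP_upper[OF _ bdd_ind_share_set(1), of "(i, J, \<delta>)"] assms by simp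

lemma inf_share_lower:
  assumes "J \<in> F" "\<delta> \<in> B"
  shows "inf_share \<mu> F B \<le> ind_share_set \<mu> i J \<delta>"
  unfolding inf_share_def using cINF_lower[OF bdd_ind_share_set(2), of "(i, J, \<delta>)"] assms by simp

lemma inf_share_nonneg: "F \<noteq> {} \<Longrightarrow> B \<noteq> {} \<Longrightarrow> 0 \<le> inf_share \<mu> F B"
  unfolding inf_share_def by (intro cINF_greatest) (auto simp: ind_share_set_bounds)

lemma sup_inside_upper: "\<delta> \<in> B \<Longrightarrow> 1 - ind_share0 \<mu> i \<delta> \<le> sup_inside \<mu> B"
proof -
  assume "\<delta> \<in> B"
  have "bdd_above ((\<lambda>(i, \<delta>). 1 - ind_share0 \<mu> i \<delta>) ` (UNIV \<times> B))"
    by (intro bdd_aboveI[of _ 1]) (auto simp: ind_share0_pos less_imp_le)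
  with \<open>\<delta> \<in> B\<close> show ?thesis
    unfolding sup_inside_def using cSUP_upper[of "(i, \<delta>)" "UNIV \<times> B"] by force
qed

lemma sup_inside_le_1: "B \<noteq> {} \<Longrightarrow> sup_inside \<mu> B \<le> 1"
  unfolding sup_inside_def by (intro cSUP_least) (auto simp: ind_share0_pos less_imp_le)

text \<open>For each type and each \<delta> the full set of products has the largest choice
  probability, namely \<open>1 - ind_share0 \<mu> i \<delta>\<close>.\<close>

lemma sup_share_eq_sup_inside:
  assumes "UNIV \<in> F" "B \<noteq> {}"
  shows "sup_share \<mu> F B = sup_inside \<mu> B"
proof (rule antisym)
  show "sup_share \<mu> F B \<le> sup_inside \<mu> B"
    unfolding sup_share_def
  proof (rule cSUP_least)
    show "UNIV \<times> F \<times> B \<noteq> {}" using assms by auto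
  qed (auto intro: order_trans[OF ind_share_set_bounds(2) sup_inside_upper])
  have "1 - ind_share0 \<mu> i \<delta> \<le> sup_share \<mu> F B" if "\<delta> \<in> B" for i \<delta>
    using sup_share_upper[OF assms(1) that, of \<mu> i] by (simp add: ind_share_set_def sum_ind_share)
  then show "sup_inside \<mu> B \<le> sup_share \<mu> F B"
    unfolding sup_inside_def by (intro cSUP_least) (use assms in auto)
qed

text \<open>The two entries of the maximum differ by \<open>(1 - \<gamma>)\<close> times the sum of
  the extrema, so the first one dominates. This expression also covers the cases 0 and 1, so one
  estimate serves all three.\<close>

lemma c_tilde_eq:
  assumes "0 \<le> \<gamma>" "\<gamma> \<le> 1" "0 \<le> inf_share \<mu> F B" "0 \<le> sup_share \<mu> F B"
  shows "c_tilde \<mu> F B \<gamma> = sup_share \<mu> F B - \<gamma> * inf_share \<mu> F B"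
proof -
  have "0 \<le> (1 - \<gamma>) * (sup_share \<mu> F B + inf_share \<mu> F B)"
    using assms by simp
  then have "\<gamma> * sup_share \<mu> F B - inf_share \<mu> F B \<le> sup_share \<mu> F B - \<gamma> * inf_share \<mu> F B"
    by (simp add: algebra_simps)
  then show ?thesis by (simp add: c_tilde_def max_def)
qed

theorem proposition4:
  fixes w :: "'i::finite \<Rightarrow> real"
    and \<mu> :: "'i \<Rightarrow> 'j::finite \<Rightarrow> real"
    and S :: "'j \<Rightarrow> real" and S0 :: real
    and B :: "(real ^ 'j) set"
    and F :: "'j set set"
    and \<gamma> :: real
    and \<delta>1 \<delta>2 :: "real ^ 'j"
  assumes "\<And>i. w i \<ge> 0" and "(\<Sum>i\<in>UNIV. w i) = 1"
    and "\<And>j. S j > 0" and "S0 > 0"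
    and "Phi w \<mu> S S0 \<gamma> ` B \<subseteq> B"
    and "F = Pow UNIV \<or> F = Pow UNIV - {{}}"
    and "\<delta>1 \<in> B" and "\<delta>2 \<in> B"
  shows
    "(0 \<le> \<gamma> \<and> \<gamma> \<le> 1 \<longrightarrow>
        (closed_segment \<delta>1 \<delta>2 \<subseteq> B \<longrightarrow>
          infnorm (Phi w \<mu> S S0 \<gamma> \<delta>1 - Phi w \<mu> S S0 \<gamma> \<delta>2)
            \<le> c_gamma w \<mu> B \<gamma> * infnorm (\<delta>1 - \<delta>2))
      \<and> infnorm (Phi w \<mu> S S0 \<gamma> \<delta>1 - Phi w \<mu> S S0 \<gamma> \<delta>2)
          \<le> c_tilde \<mu> F B \<gamma> *
              (infnorm (cmax \<delta>1 \<delta>2 - \<delta>1) + infnorm (cmax \<delta>1 \<delta>2 - \<delta>2))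
      \<and> c_tilde \<mu> F B \<gamma> *
              (infnorm (cmax \<delta>1 \<delta>2 - \<delta>1) + infnorm (cmax \<delta>1 \<delta>2 - \<delta>2))
          \<le> 2 * c_tilde \<mu> F B \<gamma> * infnorm (\<delta>1 - \<delta>2)
      \<and> (\<gamma> = 0 \<longrightarrow> sup_share \<mu> F B = sup_inside \<mu> B \<and> sup_inside \<mu> B \<le> 1)
      \<and> (\<gamma> = 1 \<longrightarrow> sup_share \<mu> F B - inf_share \<mu> F B \<le> 1))
   \<and> (\<gamma> = 0 \<longrightarrow>
        infnorm (Phi w \<mu> S S0 0 \<delta>1 - Phi w \<mu> S S0 0 \<delta>2)
          \<le> sup_inside \<mu> B * infnorm (\<delta>1 - \<delta>2)
      \<and> sup_inside \<mu> B * infnorm (\<delta>1 - \<delta>2) \<le> infnorm (\<delta>1 - \<delta>2))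
   \<and> (CARD('j) = 1 \<and> 0 \<le> \<gamma> \<and> \<gamma> \<le> 1 \<longrightarrow>
        infnorm (Phi w \<mu> S S0 \<gamma> \<delta>1 - Phi w \<mu> S S0 \<gamma> \<delta>2)
          \<le> c_tilde \<mu> F B \<gamma> * infnorm (\<delta>1 - \<delta>2)
      \<and> c_tilde \<mu> F B \<gamma> * infnorm (\<delta>1 - \<delta>2) \<le> infnorm (\<delta>1 - \<delta>2))"
proof -
  note w = assms(1,2)
  define \<sigma> \<iota> where "\<sigma> = sup_share \<mu> F B" and "\<iota> = inf_share \<mu> F B"
  \<comment> \<open>The full set identifies \<sigma> with \<open>sup_inside\<close>; the singletons
    put \<iota> below every individual choice probability. Both readings of \<open>F\<close> contain
    these sets.\<close>
  have F: "UNIV \<in> F" "{k} \<in> F" for k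
    using assms(6) by auto
  have ne: "F \<noteq> {}" "B \<noteq> {}" using F assms(7) by auto
  have \<sigma>_eq: "\<sigma> = sup_inside \<mu> B"
    unfolding \<sigma>_def by (rule sup_share_eq_sup_inside[OF F(1) ne(2)])
  have \<sigma>1: "\<sigma> \<le> 1" unfolding \<sigma>_eq by (rule sup_inside_le_1[OF ne(2)])
  have \<sigma>: "1 - ind_share0 \<mu> i \<delta> \<le> \<sigma>" if "\<delta> \<in> B" for i \<delta>
    unfolding \<sigma>_eq by (rule sup_inside_upper[OF that])
  have \<iota>0: "0 \<le> \<iota>" unfolding \<iota>_def by (rule inf_share_nonneg[OF ne])
  have \<iota>: "\<iota> \<le> ind_share \<mu> i k \<delta>" if "\<delta> \<in> B" for i k \<delta>
    using inf_share_lower[OF F(2) that, where \<mu> = \<mu> and i = i] by (simp add: \<iota>_def ind_share_set_def)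
  have \<iota>\<sigma>: "\<iota> \<le> \<sigma>"
    unfolding \<iota>_def \<sigma>_def
    using inf_share_lower[OF F(1) assms(7)] sup_share_upper[OF F(1) assms(7)] by (rule order_trans)
  define p q where "p = infnorm (cmax \<delta>1 \<delta>2 - \<delta>1)" and "q = infnorm (cmax \<delta>1 \<delta>2 - \<delta>2)"
  have pq: "p \<le> infnorm (\<delta>1 - \<delta>2)" "q \<le> infnorm (\<delta>1 - \<delta>2)"
    unfolding p_def q_def by (rule infnorm_cmax_diff_le)+
  let ?\<Delta> = "infnorm (Phi w \<mu> S S0 \<gamma> \<delta>1 - Phi w \<mu> S S0 \<gamma> \<delta>2)"
  have a: "?\<Delta> \<le> c_tilde \<mu> F B \<gamma> * (p + q) \<and> 0 \<le> c_tilde \<mu> F B \<gamma> \<and> c_tilde \<mu> F B \<gamma> \<le> 1"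
    if \<gamma>: "0 \<le> \<gamma>" "\<gamma> \<le> 1"
  proof -
    have c: "c_tilde \<mu> F B \<gamma> = \<sigma> - \<gamma> * \<iota>"
      using c_tilde_eq[OF \<gamma>, of \<mu> F B] \<iota>0 \<iota>\<sigma> unfolding \<sigma>_def \<iota>_def by simp
    have "?\<Delta> \<le> (\<sigma> - \<gamma> * \<iota>) * (p + q)"
      unfolding p_def q_def using assms(7,8)
      by (intro infnorm_Phi_diff_le_cmax w \<gamma> \<sigma> \<iota> \<iota>0 \<iota>\<sigma>)
    moreover have "0 \<le> \<gamma> * \<iota>" "\<gamma> * \<iota> \<le> \<iota>"
      using \<gamma> \<iota>0 by (auto intro: mult_left_le_one_le)
    ultimately show ?thesis unfolding c using \<sigma>1 \<iota>\<sigma> by simp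
  qed
  have mvt: "?\<Delta> \<le> c_gamma w \<mu> B \<gamma> * infnorm (\<delta>1 - \<delta>2)"
    if "0 \<le> \<gamma>" "closed_segment \<delta>1 \<delta>2 \<subseteq> B"
    by (intro infnorm_Phi_diff_le_c_gamma w that)
  have two: "c_tilde \<mu> F B \<gamma> * (p + q) \<le> 2 * c_tilde \<mu> F B \<gamma> * infnorm (\<delta>1 - \<delta>2)"
    if "0 \<le> \<gamma>" "\<gamma> \<le> 1"
    using mult_left_mono[of "p + q" "2 * infnorm (\<delta>1 - \<delta>2)" "c_tilde \<mu> F B \<gamma>"] a[OF that] pq
    by (simp add: mult.assoc mult.left_commute)
  have b: "infnorm (Phi w \<mu> S S0 0 \<delta>1 - Phi w \<mu> S S0 0 \<delta>2) \<le> \<sigma> * infnorm (\<delta>1 - \<delta>2)"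
    using assms(7,8) \<iota>0 \<iota>\<sigma> by (intro infnorm_Phi_0_diff_le w \<sigma>) auto
  have le1: "c * infnorm (\<delta>1 - \<delta>2) \<le> infnorm (\<delta>1 - \<delta>2)" if "c \<le> 1" for c
    using mult_right_mono[OF that infnorm_pos_le, of "\<delta>1 - \<delta>2"] by simp
  \<comment> \<open>With a single product the displacement cannot be both upward and downward, so
    one of \<open>p\<close> and \<open>q\<close> is 0 and the sum is the absolute
    displacement.\<close>
  have single: "p + q \<le> infnorm (\<delta>1 - \<delta>2)" if card: "CARD('j) = 1"
  proof -
    obtain k l where k: "p = max 0 (\<delta>2 $ k - \<delta>1 $ k)" and l: "q = max 0 (\<delta>1 $ l - \<delta>2 $ l)"
      unfolding p_def q_def
      using infnorm_attained[of "cmax \<delta>1 \<delta>2 - \<delta>1"] infnorm_attained[of "cmax \<delta>1 \<delta>2 - \<delta>2"]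
      unfolding cmax_diff_nth by auto
    have "k = l" using card by (metis UNIV_I card_1_singletonE singletonD)
    then show ?thesis
      using k l component_le_infnorm_cart[of "\<delta>1 - \<delta>2" l] by (auto simp: max_def abs_if split: if_splits)
  qed
  have c: "?\<Delta> \<le> c_tilde \<mu> F B \<gamma> * infnorm (\<delta>1 - \<delta>2)"
    if "CARD('j) = 1" "0 \<le> \<gamma>" "\<gamma> \<le> 1"
    using a[OF that(2,3)] mult_left_mono[OF single[OF that(1)], of "c_tilde \<mu> F B \<gamma>"] by linarith
  show ?thesis
    unfolding p_def[symmetric] q_def[symmetric] \<sigma>_def[symmetric] \<iota>_def[symmetric] \<sigma>_eq[symmetric]
    using a mvt two b c le1 \<sigma>1 \<iota>0 by (intro conjI impI) simp_all
qed

end
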